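(* (i) Let $b\ge 1$, $w=1/b$, $\lambda>0$, and let $\mathcal L$ be the softmax cross-entropy loss averaged over a mini-batch of $b$ samples, regarded as a function of the smashed data $s$. Suppose that the labels $y_1,\dots,y_b$ of the mini-batch are drawn independently, with $y_j$ drawn from the predictive distribution $p_j=\operatorname{softmax}(\phi_j(s_0))$ of sample $j$ at the round-initial output. Let $g_0=\nabla_s\mathcal L(s_0)$, $\widehat B_{\mathrm D}=\lambda\operatorname{diag}(g_0\odot g_0)$, and $G=J_s^{\top}\Lambda J_s$, where $J_s$ is the Jacobian of the server output at $s_0$ and $\Lambda$ is the Hessian of the mini-batch loss with respect to the server output at $\phi(s_0)$. Then, with the expectation taken over the labels, $$\mathbb E[\widehat B_{\mathrm D}]=\lambda\, w\operatorname{diag}(G).$$ (ii) Let $\mathcal L:\mathbb R^n\to\mathbb R$ be a loss as a function of the smashed data (server-side model fixed), let $s_0,\delta\in\mathbb R^n$, $s=s_0+\delta$, $g_0=\nabla\mathcal L(s_0)$, $g=\nabla\mathcal L(s)$, $D=\operatorname{diag}(g_0\odot g_0)$ and $\bar H=\int_0^1\nabla^2\mathcal L(s_0+\tau\delta)\,d\tau$. Suppose $D\delta\ne 0$ and put $$\lambda^\star:=\frac{\langle D\delta,\bar H\delta\rangle}{\lVert D\delta\rVert^2}.$$ For $\lambda>0$, let $\widetilde g_{\mathrm D}=g_0+\lambda D\delta$. Then $\lVert\widetilde g_{\mathrm D}-g\rVert<\lVert g_0-g\rVert$ if and only if $\lambda<2\lambda^\star$.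
   Context: Setting: the server-side model is a fixed map $\phi$ from the smashed data (cut-layer activations) to the server output; its parameters are fixed at their round-initial value. $s_0$ is the smashed data transmitted at the start of the round, $s=s_0+\delta$ the current smashed data, and $\delta$ the displacement. $\lVert\cdot\rVert$ is the Euclidean norm, $\odot$ the entrywise product. $\operatorname{diag}(v)$ of a vector $v$ is the diagonal matrix with diagonal $v$; $\operatorname{diag}(A)$ of a square matrix $A$ is the diagonal matrix with the same diagonal entries as $A$. For (i): a mini-batch consists of $b$ samples. The smashed data $s\in\mathbb R^n$ stacks the smashed data of all samples, and the server output $\phi(s)=(\phi_1(s),\dots,\phi_b(s))\in\mathbb R^{bC}$ stacks the per-sample outputs (logits) $\phi_j(s)\in\mathbb R^C$, where $\phi_j$ depends only on the smashed data of sample $j$; $\phi$ is differentiable at $s_0$. The averaged loss is $\mathcal L(s)=\frac1b\sum_{j=1}^b\ell(\phi_j(s),y_j)$ with $\ell(u,y)=-\log\operatorname{softmax}(u)_y$ and $y_j\in\{1,\dots,C\}$. $J_s=\partial\phi/\partial s$ at $s_0$ (a $bC\times n$ matrix). $\Lambda$ is the $bC\times bC$ Hessian, with respect to the stacked output, of the averaged loss $u\mapsto\frac1b\sum_j\ell(u_j,y_j)$, evaluated at $\phi(s_0)$ (so it includes the factor $w=1/b$). $G$ is the generalized Gauss–Newton matrix. For (ii): $\mathcal L$ is twice continuously differentiable on a neighbourhood of the segment from $s_0$ to $s_0+\delta$. Using $g_0$ in place of the fresh gradient $g$ is called gradient reuse; $\widetilde g_{\mathrm D}$ is the compensated gradient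 of CoeF-D. Thus (ii) says exactly when CoeF-D has a smaller feedback error than gradient reuse at the given displacement. *)

theory Defs
  imports "HOL-Probability.Probability"
begin

definition grad :: "(real ^ 'n \<Rightarrow> real) \<Rightarrow> real ^ 'n \<Rightarrow> real ^ 'n" where
  "grad f x = (THE D. GDERIV f x :> D)"

definition hessian :: "(real ^ 'n \<Rightarrow> real) \<Rightarrow> real ^ 'n \<Rightarrow> real ^ 'n ^ 'n" where
  "hessian f x = jacobian (grad f) (at x)"

definition twice_continuously_differentiable_on ::
    "(real ^ 'n \<Rightarrow> real) \<Rightarrow> (real ^ 'n) set \<Rightarrow> bool" where
  "twice_continuously_differentiable_on f U \<longleftrightarrow>
     open U \<and>
     (\<forall>x\<in>U. f differentiable (at x)) \<and>
     (\<forall>x\<in>U. grad f differentiable (at x)) \<and>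
     continuous_on U (hessian f)"

definition diag_of_vec :: "real ^ 'n \<Rightarrow> real ^ 'n ^ 'n" where
  "diag_of_vec v = (\<chi> i j. if i = j then v $ i else 0)"

definition diag_of_mat :: "real ^ 'n ^ 'n \<Rightarrow> real ^ 'n ^ 'n" where
  "diag_of_mat A = (\<chi> i j. if i = j then A $ i $ j else 0)"

definition softmax :: "real ^ 'c \<Rightarrow> real ^ 'c" where
  "softmax u = (\<chi> k. exp (u $ k) / (\<Sum>l\<in>UNIV. exp (u $ l)))"

definition ce_loss :: "real ^ 'c \<Rightarrow> 'c \<Rightarrow> real" where
  "ce_loss u y = - ln (softmax u $ y)"

(* Samples are indexed by 'b and classes by 'c, so b = CARD('b) and C = CARD('c).
   A stacked output is a vector indexed by the product 'b \<times> 'c. *)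

definition block :: "real ^ ('b::finite \<times> 'c::finite) \<Rightarrow> 'b \<Rightarrow> real ^ 'c" where
  "block u j = (\<chi> k. u $ (j, k))"

definition batch_ce_loss :: "('b::finite \<Rightarrow> 'c::finite) \<Rightarrow> real ^ ('b::finite \<times> 'c::finite) \<Rightarrow> real" where
  "batch_ce_loss y u = (1 / real CARD('b)) * (\<Sum>j\<in>UNIV. ce_loss (block u j) (y j))"

(* own i is the sample to which coordinate i of the stacked smashed data belongs. *)
definition samplewise ::
    "('n \<Rightarrow> 'b) \<Rightarrow> (real ^ 'n \<Rightarrow> real ^ ('b::finite \<times> 'c::finite)) \<Rightarrow> bool" where
  "samplewise own \<phi> \<longleftrightarrow>
     (\<forall>j s t. (\<forall>i. own i = j \<longrightarrow> s $ i = t $ i) \<longrightarrow> block (\<phi> s) j = block (\<phi> t) j)"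

end

(* For (i), coordinate i of the gradient is (a . p - a_Y) / b, where p is the predictive
   distribution of the sample owning coordinate i, Y its label, and a the i-th column of the
   Jacobian restricted to that sample's logits; the other blocks of the column vanish because
   the output is samplewise. The mean square of this is the variance of a under p divided by b^2,
   and the i-th diagonal entry of G is the same variance divided by b, since the softmax Hessian
   diag(p) - p p^T is the covariance form of p.
   For (ii), the fundamental theorem of calculus gives g - g0 = H delta, and expanding the
   squared norm of mu D delta - H delta leaves a quadratic inequality in mu. *)
theory Submission
  imports Defs
begin

section \<open>Gradients, Jacobians and congruences\<close>

text \<open>\<open>grad\<close> is a definite description, so it has a known value only after
  uniqueness: the derivative is unique, and a vector is determined by its inner products with all
  vectors.\<close>

lemma grad_eqI:
  assumes "(f has_derivative (\<lambda>h. h \<bullet> D)) (at x)"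
  shows "grad f x = D"
proof -
  have "D' = D" if "GDERIV f x :> D'" for D'
    using has_derivative_unique[OF that[unfolded gderiv_def] assms]
    by (metis inner_commute vector_eq_ldot)
  moreover have "GDERIV f x :> D"
    using assms by (simp add: gderiv_def)
  ultimately show ?thesis
    unfolding grad_def by (rule the_equality[rotated])
qed

lemma jacobian_mult:
  fixes f :: "real ^ 'n \<Rightarrow> real ^ 'm"
  assumes "(f has_derivative A) (at x)"
  shows "jacobian f (at x) *v v = A v"
proof -
  have "f differentiable (at x)"
    using assms by (auto simp: differentiable_def)
  then show ?thesis
    using has_derivative_unique[OF assms] by (simp add: jacobian_works)
qed

lemma column_jacobian:
  fixes f :: "real ^ 'n \<Rightarrow> real ^ 'm"
  assumes "(f has_derivative A) (at x)"
  shows "column i (jacobian f (at x)) = A (axis i 1)"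
  by (simp add: jacobian_mult[OF assms] flip: matrix_vector_mult_basis)

text \<open>Write the diagonal entry as the quadratic form of the i-th unit vector and move
  \<open>transpose J\<close> across the inner product. A diagonal entry of G then involves one
  column of the Jacobian, and the Hessian only through its action on that column.\<close>

lemma diag_congruence:
  fixes J :: "real ^ 'n ^ 'k" and A :: "real ^ 'k ^ 'k"
  shows "(transpose J ** A ** J) $ i $ i = column i J \<bullet> (A *v column i J)"
proof -
  have "(transpose J ** A ** J) $ i $ i = ((transpose J ** A ** J) *v axis i 1) $ i"
    by (simp add: matrix_vector_mult_basis column_def)
  also have "\<dots> = (transpose J *v (A *v (J *v axis i 1))) $ i"
    by (simp only: matrix_vector_mul_assoc matrix_mul_assoc)
  also have "\<dots> = column i J \<bullet> (A *v (J *v axis i 1))"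
    by (simp add: matrix_vector_mult_def transpose_def column_def inner_vec_def)
  finally show ?thesis
    by (simp add: matrix_vector_mult_basis)
qed

section \<open>Derivatives of softmax and of the cross-entropy loss\<close>

lemma sum_exp_pos: "(\<Sum>l\<in>UNIV. exp ((u :: real ^ 'c) $ l)) > 0"
  by (intro sum_pos) auto

lemma sum_softmax: "(\<Sum>k\<in>UNIV. softmax u $ k) = 1"
  using sum_exp_pos[of u] by (simp add: softmax_def flip: sum_divide_distrib)

text \<open>The log-sum-exp form, in which the label enters only through a linear term.\<close>

lemma ce_loss_eq: "ce_loss u y = ln (\<Sum>l\<in>UNIV. exp (u $ l)) - u $ y"
  using sum_exp_pos[of u] by (simp add: ce_loss_def softmax_def ln_div)

lemma has_derivative_sum_exp:
  "((\<lambda>u :: real ^ 'c. \<Sum>l\<in>UNIV. exp (u $ l)) has_derivative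
    (\<lambda>h. \<Sum>l\<in>UNIV. exp (u $ l) * h $ l)) (at u)"
  by (auto intro!: derivative_eq_intros bounded_linear_imp_has_derivative bounded_linear_vec_nth
      simp: mult_ac)

lemma has_derivative_ce_loss:
  "((\<lambda>u. ce_loss u y) has_derivative (\<lambda>h. h \<bullet> softmax u - h $ y)) (at u)"
proof -
  have "((\<lambda>u. ln (\<Sum>l\<in>UNIV. exp (u $ l)) - u $ y) has_derivative
      (\<lambda>h. (\<Sum>l\<in>UNIV. exp (u $ l) * h $ l) / (\<Sum>l\<in>UNIV. exp (u $ l)) - h $ y)) (at u)"
    using sum_exp_pos[of u]
    by (auto intro!: derivative_eq_intros has_derivative_sum_exp
        bounded_linear_imp_has_derivative bounded_linear_vec_nth simp: divide_inverse mult_ac)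
  then show ?thesis
    by (simp add: ce_loss_eq softmax_def inner_vec_def sum_divide_distrib mult_ac)
qed

text \<open>Quotient rule. With p = \<open>softmax u\<close>, the number
  \<open>h \<bullet> softmax u\<close> is the mean of h under p, so the derivative is row k of
  diag(p) - p p^T applied to h.\<close>

lemma has_derivative_softmax:
  "((\<lambda>u. softmax u $ k) has_derivative (\<lambda>h. softmax u $ k * (h $ k - h \<bullet> softmax u))) (at u)"
proof -
  let ?S = "\<Sum>l\<in>UNIV. exp (u $ l)"
  have "((\<lambda>u. exp (u $ k) / (\<Sum>l\<in>UNIV. exp (u $ l))) has_derivative
      (\<lambda>h. - (exp (u $ k)) * (inverse ?S * (\<Sum>l\<in>UNIV. exp (u $ l) * h $ l) * inverse ?S)
           + exp (u $ k) * h $ k / ?S)) (at u)"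
  proof (intro has_derivative_divide has_derivative_sum_exp)
    show "((\<lambda>u. exp (u $ k)) has_derivative (\<lambda>h. exp (u $ k) * h $ k)) (at u)"
      by (auto intro!: derivative_eq_intros bounded_linear_imp_has_derivative bounded_linear_vec_nth)
  qed (use sum_exp_pos[of u] in auto)
  moreover have "h \<bullet> softmax u = (\<Sum>l\<in>UNIV. exp (u $ l) * h $ l) / ?S" for h
    by (simp add: softmax_def inner_vec_def sum_divide_distrib mult_ac)
  then have "- (exp (u $ k)) * (inverse ?S * (\<Sum>l\<in>UNIV. exp (u $ l) * h $ l) * inverse ?S)
      + exp (u $ k) * h $ k / ?S = softmax u $ k * (h $ k - h \<bullet> softmax u)" for h
    by (simp add: divide_inverse algebra_simps) (simp add: softmax_def divide_inverse)
  ultimately show ?thesis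
    by (simp add: softmax_def)
qed

section \<open>Gradient and Hessian of the batch loss in the stacked output\<close>

lemma bounded_linear_block: "bounded_linear (\<lambda>u. block u j)"
  by (rule linear_conv_bounded_linear[THEN iffD1], rule linearI)
    (simp_all add: block_def vec_eq_iff)

lemma inner_block: "u \<bullet> v = (\<Sum>j\<in>UNIV. block u j \<bullet> block v j)"
  by (simp add: inner_vec_def block_def sum.cartesian_product flip: UNIV_Times_UNIV)

lemma has_derivative_batch_ce_loss:
  fixes u :: "real ^ ('b::finite \<times> 'c::finite)"
  shows "(batch_ce_loss y has_derivative
    (\<lambda>h. (1 / real CARD('b)) *
      (\<Sum>j\<in>UNIV. block h j \<bullet> softmax (block u j) - block h j $ y j))) (at u)"
  unfolding batch_ce_loss_def
  by (intro has_derivative_mult_right has_derivative_sum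
      has_derivative_compose[OF bounded_linear_imp_has_derivative[OF bounded_linear_block]
        has_derivative_ce_loss])

lemma grad_batch_ce_loss:
  fixes u :: "real ^ ('b::finite \<times> 'c::finite)"
  shows "grad (batch_ce_loss y) u =
    (\<chi> jk. (1 / real CARD('b)) *
      (softmax (block u (fst jk)) $ snd jk - (if y (fst jk) = snd jk then 1 else 0)))" (is "_ = ?D")
proof (rule grad_eqI)
  have "h \<bullet> ?D = (1 / real CARD('b)) *
      (\<Sum>j\<in>UNIV. block h j \<bullet> softmax (block u j) - block h j $ y j)" for h
  proof -
    \<comment> \<open>Each block is w times (prediction minus one-hot label); pairing with the
      one-hot vector picks out the labelled logit.\<close>
    have "block ?D j = (1 / real CARD('b)) *\<^sub>R (softmax (block u j) - axis (y j) 1)" for j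
      by (auto simp: block_def vec_eq_iff axis_def)
    then show ?thesis
      by (simp add: inner_block inner_diff_right inner_axis sum_distrib_left sum_divide_distrib)
  qed
  then show "(batch_ce_loss y has_derivative (\<lambda>h. h \<bullet> ?D)) (at u)"
    using has_derivative_batch_ce_loss[of y u] by simp
qed

text \<open>The labels contribute only a constant to the gradient, so they disappear here. The
  Hessian is block diagonal with blocks w (diag(p) - p p^T); its action on a vector is the form that
  \<open>diag_congruence\<close> calls for.\<close>

lemma hessian_batch_ce_loss_mult:
  fixes u :: "real ^ ('b::finite \<times> 'c::finite)"
  shows "hessian (batch_ce_loss y) u *v v =
    (\<chi> jk. (1 / real CARD('b)) * (softmax (block u (fst jk)) $ snd jk *
      (v $ jk - block v (fst jk) \<bullet> softmax (block u (fst jk)))))"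
proof -
  have "(grad (batch_ce_loss y) has_derivative
    (\<lambda>v. \<chi> jk. (1 / real CARD('b)) * (softmax (block u (fst jk)) $ snd jk *
      (block v (fst jk) $ snd jk - block v (fst jk) \<bullet> softmax (block u (fst jk)))))) (at u)"
  proof -
    \<comment> \<open>The constant \<open>e\<close> stands for the label indicator in the
      gradient.\<close>
    have "((\<lambda>u. (1 / real CARD('b)) * (softmax (block u j) $ k - e)) has_derivative
        (\<lambda>v. (1 / real CARD('b)) *
          (softmax (block u j) $ k * (block v j $ k - block v j \<bullet> softmax (block u j)) - 0))) (at u)"
      for j k e
      by (intro has_derivative_mult_right has_derivative_diff has_derivative_const
          has_derivative_compose[OF bounded_linear_imp_has_derivative[OF bounded_linear_block]
            has_derivative_softmax])
    then show ?thesis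
      unfolding grad_batch_ce_loss[abs_def]
      by (subst has_derivative_componentwise_within) (simp add: Basis_vec_def inner_axis)
  qed
  from jacobian_mult[OF this, of v] show ?thesis
    by (simp add: hessian_def block_def)
qed

section \<open>Block structure of the Jacobian of a samplewise output\<close>

text \<open>Moving from s along the i-th axis changes no coordinate owned by sample j, so block j of
  the output is constant on that line, and by the chain rule its derivative there is the block in
  question.\<close>

lemma samplewise_derivative_zero:
  assumes "samplewise own \<phi>" and "(\<phi> has_derivative A) (at s)" and "own i \<noteq> j"
  shows "block (A (axis i 1)) j = 0"
proof -
  let ?f = "\<lambda>t :: real. block (\<phi> (s + t *\<^sub>R axis i 1)) j"
  have "((\<lambda>t :: real. s + t *\<^sub>R axis i 1) has_derivative (\<lambda>t. t *\<^sub>R axis i 1)) (at 0)"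
    by (auto intro!: derivative_eq_intros)
  \<comment> \<open>The chain rule at t = 0 needs the base point written as the value of the line at
    0.\<close>
  moreover have "(\<phi> has_derivative A) (at (s + (0::real) *\<^sub>R axis i 1))"
    using assms(2) by simp
  ultimately have "((\<lambda>t. \<phi> (s + t *\<^sub>R axis i 1)) has_derivative (\<lambda>t. A (t *\<^sub>R axis i 1))) (at 0)"
    by (rule has_derivative_compose)
  then have "(?f has_derivative (\<lambda>t. block (A (t *\<^sub>R axis i 1)) j)) (at 0)"
    by (rule bounded_linear.has_derivative[OF bounded_linear_block])
  moreover have "?f = (\<lambda>_. block (\<phi> s) j)"
    by (rule ext, rule assms(1)[unfolded samplewise_def, rule_format])
      (use assms(3) in \<open>auto simp: axis_def\<close>)
  ultimately have "((\<lambda>_. block (\<phi> s) j) has_derivative (\<lambda>t. block (A (t *\<^sub>R axis i 1)) j)) (at (0::real))"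
    by (simp only:)
  \<comment> \<open>Evaluating the two equal derivatives at t = 1 returns the column itself.\<close>
  from fun_cong[OF has_derivative_unique[OF this has_derivative_const], of 1]
  show ?thesis by simp
qed

section \<open>Expectation of the squared gradient under sampled labels\<close>

text \<open>Both sides are the variance of a under p. With m the mean, (a - m)^2 = a (a - m) - m (a
  - m), and the last term averages to zero because the weights sum to 1.\<close>

lemma weighted_variance:
  fixes a p :: "real ^ 'c"
  assumes "(\<Sum>k\<in>UNIV. p $ k) = 1"
  shows "(\<Sum>c\<in>UNIV. p $ c * (a \<bullet> p - a $ c)\<^sup>2) = (\<Sum>k\<in>UNIV. a $ k * (p $ k * (a $ k - a \<bullet> p)))"
proof -
  let ?m = "a \<bullet> p"
  have "(\<Sum>c\<in>UNIV. p $ c * (?m - a $ c)\<^sup>2) =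
      (\<Sum>k\<in>UNIV. a $ k * (p $ k * (a $ k - ?m)) + (?m\<^sup>2 * p $ k - ?m * (a $ k * p $ k)))"
    by (intro sum.cong) (auto simp: algebra_simps power2_eq_square)
  also have "\<dots> = (\<Sum>k\<in>UNIV. a $ k * (p $ k * (a $ k - ?m)))
      + (?m\<^sup>2 * (\<Sum>k\<in>UNIV. p $ k) - ?m * (\<Sum>k\<in>UNIV. a $ k * p $ k))"
    by (simp only: sum.distrib sum_subtractf sum_distrib_left)
  finally show ?thesis
    using assms by (simp add: inner_vec_def power2_eq_square)
qed

text \<open>This is (i), with integrability and value given together by
  \<open>has_bochner_integral\<close>. The labelling \<open>y\<close> is arbitrary because the
  Hessian does not depend on it.\<close>

lemma expectation_diag_fisher:
  fixes \<phi> :: "real ^ 'n \<Rightarrow> real ^ ('b::finite \<times> 'c::finite)"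
    and Y :: "'b \<Rightarrow> 'w \<Rightarrow> 'c"
  assumes own: "samplewise own \<phi>"
    and diff: "\<phi> differentiable (at s)"
    and M: "prob_space M"
    and meas: "\<And>j. Y j \<in> M \<rightarrow>\<^sub>M count_space UNIV"
    and dist: "\<And>j k. measure M {\<omega> \<in> space M. Y j \<omega> = k} = softmax (block (\<phi> s) j) $ k"
  defines "g \<equiv> \<lambda>\<omega>. grad (\<lambda>s. batch_ce_loss (\<lambda>j. Y j \<omega>) (\<phi> s)) s"
  shows "has_bochner_integral M (\<lambda>\<omega>. lam *\<^sub>R diag_of_vec (g \<omega> * g \<omega>))
    ((lam * (1 / real CARD('b))) *\<^sub>R
      diag_of_mat (transpose (jacobian \<phi> (at s)) ** hessian (batch_ce_loss y) (\<phi> s) **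
        jacobian \<phi> (at s)))"
proof -
  interpret prob_space M by fact
  obtain A where A: "(\<phi> has_derivative A) (at s)"
    using diff by (auto simp: differentiable_def)
  define w where "w = 1 / real CARD('b)"
  \<comment> \<open>The only block of the i-th Jacobian column that can be nonzero.\<close>
  define a where "a i = block (A (axis i 1)) (own i)" for i
  define p where "p j = softmax (block (\<phi> s) j)" for j
  \<comment> \<open>The i-th gradient coordinate in the event that the owning sample has label
    k.\<close>
  define c where "c i k = w * (a i \<bullet> p (own i) - a i $ k)" for i k
  \<comment> \<open>Matrix units on the diagonal; expanding in them reduces the matrix-valued
    integral to scalar ones.\<close>
  define E :: "'n \<Rightarrow> real ^ 'n ^ 'n" where "E i = axis i (axis i 1)" for i
  have diag: "diag_of_vec v = (\<Sum>i\<in>UNIV. v $ i *\<^sub>R E i)" for v :: "real ^ 'n"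
  proof -
    have "(if i = k then v $ i else 0) = (\<Sum>x\<in>UNIV. v $ x * (E x $ i $ k))" for i k
    proof -
      have "(\<Sum>x\<in>UNIV. v $ x * (E x $ i $ k)) =
          (\<Sum>x\<in>UNIV. if x = i then (if i = k then v $ i else 0) else 0)"
        by (intro sum.cong) (auto simp: E_def axis_def)
      then show ?thesis by simp
    qed
    then show ?thesis by (simp add: diag_of_vec_def vec_eq_iff)
  qed
  have block_A: "block (A (axis i 1)) j = (if j = own i then a i else 0)" for i j
    using samplewise_derivative_zero[OF own A] by (auto simp: a_def)
  have g: "g \<omega> = (\<chi> i. c i (Y (own i) \<omega>))" for \<omega>
    unfolding g_def
  proof (rule grad_eqI)
    define F where "F h = w * (\<Sum>j\<in>UNIV. block (A h) j \<bullet> p j - block (A h) j $ Y j \<omega>)" for h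
    have F: "((\<lambda>s. batch_ce_loss (\<lambda>j. Y j \<omega>) (\<phi> s)) has_derivative F) (at s)"
      using has_derivative_compose[OF A has_derivative_batch_ce_loss]
      by (simp add: w_def p_def F_def[abs_def])
    note linear = has_derivative_linear[OF F]
    have F_axis: "F (axis i 1) = c i (Y (own i) \<omega>)" for i
    proof -
      have "(\<Sum>j\<in>UNIV. block (A (axis i 1)) j \<bullet> p j - block (A (axis i 1)) j $ Y j \<omega>) =
          (\<Sum>j\<in>UNIV. if j = own i then a i \<bullet> p (own i) - a i $ Y (own i) \<omega> else 0)"
        by (intro sum.cong) (auto simp: block_A)
      then show ?thesis by (simp add: F_def c_def)
    qed
    \<comment> \<open>Linearity: the values of F on the axis vectors are the coordinates of the
      gradient.\<close>
    have "F h = h \<bullet> (\<chi> i. c i (Y (own i) \<omega>))" for h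
    proof -
      have "F h = F (\<Sum>i\<in>UNIV. h $ i *\<^sub>R axis i 1)"
        by (simp add: basis_expansion flip: scalar_mult_eq_scaleR)
      also have "\<dots> = (\<Sum>i\<in>UNIV. h $ i * F (axis i 1))"
        by (simp add: linear_sum[OF linear] linear_scale[OF linear])
      finally show ?thesis
        by (simp add: inner_vec_def F_axis)
    qed
    then show "((\<lambda>s. batch_ce_loss (\<lambda>j. Y j \<omega>) (\<phi> s)) has_derivative
        (\<lambda>h. h \<bullet> (\<chi> i. c i (Y (own i) \<omega>)))) (at s)"
      by (rule has_derivative_eq_rhs[OF F ext])
  qed
  \<comment> \<open>The left side carries w^2 from the squared gradient, while G carries a single w
    from the Hessian; the quotient is the factor w of the claim.\<close>
  have fisher: "(\<Sum>k\<in>UNIV. p (own i) $ k * (c i k)\<^sup>2) =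
      w * (transpose (jacobian \<phi> (at s)) ** hessian (batch_ce_loss y) (\<phi> s) **
        jacobian \<phi> (at s)) $ i $ i" for i
  proof -
    let ?v = "A (axis i 1)"
    let ?h = "hessian (batch_ce_loss y) (\<phi> s) *v ?v"
    have "?v \<bullet> ?h = (\<Sum>j\<in>UNIV. block ?v j \<bullet> block ?h j)"
      by (rule inner_block)
    also have "\<dots> = (\<Sum>j\<in>UNIV. if j = own i then a i \<bullet> block ?h (own i) else 0)"
      by (intro sum.cong) (auto simp: block_A)
    also have "\<dots> = a i \<bullet> block ?h (own i)"
      by simp
    also have "block ?h (own i) = w *\<^sub>R (\<chi> k. p (own i) $ k * (a i $ k - a i \<bullet> p (own i)))"
      unfolding hessian_batch_ce_loss_mult
      by (simp add: block_def vec_eq_iff a_def p_def w_def)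
    also have "a i \<bullet> \<dots> = w * (\<Sum>k\<in>UNIV. a i $ k * (p (own i) $ k * (a i $ k - a i \<bullet> p (own i))))"
      by (simp add: inner_vec_def sum_distrib_left mult.left_commute[of _ w])
    also have "\<dots> = w * (\<Sum>k\<in>UNIV. p (own i) $ k * (a i \<bullet> p (own i) - a i $ k)\<^sup>2)"
      by (subst weighted_variance) (simp_all add: p_def sum_softmax)
    finally show ?thesis
      by (simp add: diag_congruence column_jacobian[OF A] c_def power_mult_distrib
          power2_eq_square sum_distrib_left mult_ac)
  qed
  let ?I = "\<lambda>j k. {\<omega> \<in> space M. Y j \<omega> = k}"
  \<comment> \<open>The distribution of the labels enters here, as the integral of each label
    event's indicator.\<close>
  have I: "has_bochner_integral M (indicator (?I j k) :: _ \<Rightarrow> real) (p j $ k)" for j k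
  proof -
    have "?I j k \<in> sets M"
      using measurable_sets[OF meas[of j], of "{k}"]
      by (simp add: vimage_def Int_def conj_commute)
    from has_bochner_integral_real_indicator[OF this] show ?thesis
      by (simp add: dist p_def emeasure_eq_measure)
  qed
  \<comment> \<open>The random matrix takes finitely many values, so it is integrated as a finite
    combination of indicators of label events.\<close>
  have "has_bochner_integral M
      (\<lambda>\<omega>. \<Sum>i\<in>UNIV. \<Sum>k\<in>UNIV. indicator (?I (own i) k) \<omega> *\<^sub>R ((lam * (c i k)\<^sup>2) *\<^sub>R E i))
      (\<Sum>i\<in>UNIV. \<Sum>k\<in>UNIV. p (own i) $ k *\<^sub>R ((lam * (c i k)\<^sup>2) *\<^sub>R E i))"
    by (intro has_bochner_integral_sum has_bochner_integral_scaleR_left I)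
  also have "(\<Sum>i\<in>UNIV. \<Sum>k\<in>UNIV. p (own i) $ k *\<^sub>R ((lam * (c i k)\<^sup>2) *\<^sub>R E i)) =
      (\<Sum>i\<in>UNIV. (lam * (\<Sum>k\<in>UNIV. p (own i) $ k * (c i k)\<^sup>2)) *\<^sub>R E i)"
    by (simp add: sum_distrib_left mult_ac flip: scaleR_left.sum)
  also have "\<dots> = (lam * w) *\<^sub>R
      diag_of_mat (transpose (jacobian \<phi> (at s)) ** hessian (batch_ce_loss y) (\<phi> s) **
        jacobian \<phi> (at s))" (is "_ = _ *\<^sub>R diag_of_mat ?G")
  proof -
    have "diag_of_mat ?G = diag_of_vec (\<chi> i. ?G $ i $ i)"
      by (auto simp: diag_of_mat_def diag_of_vec_def vec_eq_iff)
    then show ?thesis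
      by (simp add: fisher diag scaleR_right.sum mult_ac)
  qed
  finally have main: "has_bochner_integral M
      (\<lambda>\<omega>. \<Sum>i\<in>UNIV. \<Sum>k\<in>UNIV. indicator (?I (own i) k) \<omega> *\<^sub>R ((lam * (c i k)\<^sup>2) *\<^sub>R E i))
      ((lam * w) *\<^sub>R diag_of_mat ?G)" .
  \<comment> \<open>At a point of the space exactly one label event of the owning sample holds, so
    the inner sum collapses to one term.\<close>
  have eq: "(\<Sum>i\<in>UNIV. \<Sum>k\<in>UNIV. indicator (?I (own i) k) \<omega> *\<^sub>R ((lam * (c i k)\<^sup>2) *\<^sub>R E i)) =
      lam *\<^sub>R diag_of_vec (g \<omega> * g \<omega>)" if "\<omega> \<in> space M" for \<omega>
  proof -
    have "(\<Sum>k\<in>UNIV. indicator (?I (own i) k) \<omega> *\<^sub>R ((lam * (c i k)\<^sup>2) *\<^sub>R E i)) =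
        (\<Sum>k\<in>UNIV. if Y (own i) \<omega> = k then (lam * (c i k)\<^sup>2) *\<^sub>R E i else 0)" for i
      using that by (intro sum.cong) auto
    then show ?thesis
      by (simp add: diag g scaleR_right.sum power2_eq_square)
  qed
  show ?thesis
    unfolding w_def[symmetric]
    by (rule has_bochner_integral_cong[THEN iffD1, OF refl eq refl main])
qed

section \<open>Gradient displacement and the feedback error comparison\<close>

text \<open>The fundamental theorem of calculus for \<open>grad L\<close> along the segment,
  followed by pulling the fixed vector \<delta> out of the integral.\<close>

lemma grad_diff_eq_hessian_integral:
  assumes "closed_segment r (r + \<delta>) \<subseteq> U" and "twice_continuously_differentiable_on L U"
  shows "integral {0..1} (\<lambda>\<tau>. hessian L (r + \<tau> *\<^sub>R \<delta>)) *v \<delta> = grad L (r + \<delta>) - grad L r"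
proof -
  let ?\<gamma> = "\<lambda>\<tau>::real. r + \<tau> *\<^sub>R \<delta>"
  have \<gamma>U: "?\<gamma> \<tau> \<in> U" if "\<tau> \<in> {0..1}" for \<tau>
    using assms(1) that by (force simp: closed_segment_def algebra_simps)
  have "((\<lambda>\<tau>. grad L (?\<gamma> \<tau>)) has_vector_derivative hessian L (?\<gamma> \<tau>) *v \<delta>) (at \<tau> within {0..1})"
    if \<tau>: "\<tau> \<in> {0..1}" for \<tau>
  proof -
    obtain A where A: "(grad L has_derivative A) (at (?\<gamma> \<tau>))"
      using assms(2) \<gamma>U[OF \<tau>]
      by (auto simp: twice_continuously_differentiable_on_def differentiable_def)
    have "(?\<gamma> has_derivative (\<lambda>h. h *\<^sub>R \<delta>)) (at \<tau> within {0..1})"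
      by (auto intro!: derivative_eq_intros)
    from has_derivative_compose[OF this A] show ?thesis
      using linear_scale[OF has_derivative_linear[OF A]]
      by (simp add: has_vector_derivative_def hessian_def jacobian_mult[OF A])
  qed
  then have ftc: "((\<lambda>\<tau>. hessian L (?\<gamma> \<tau>) *v \<delta>) has_integral (grad L (?\<gamma> 1) - grad L (?\<gamma> 0))) {0..1}"
    by (intro fundamental_theorem_of_calculus) auto
  \<comment> \<open>The theorem above integrates only the Hessian applied to \<delta>; integrability
    of the Hessian matrix itself comes from its continuity on U.\<close>
  have "continuous_on {0..1} (\<lambda>\<tau>. hessian L (?\<gamma> \<tau>))"
  proof (rule continuous_on_compose2[where g = "hessian L" and f = "?\<gamma>" and t = U])
    show "continuous_on U (hessian L)"
      using assms(2) by (simp add: twice_continuously_differentiable_on_def)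
    show "continuous_on {0..1} ?\<gamma>"
      by (intro continuous_intros)
  qed (use \<gamma>U in blast)
  then have int: "(\<lambda>\<tau>. hessian L (?\<gamma> \<tau>)) integrable_on {0..1}"
    by (rule integrable_continuous_real)
  have "linear (\<lambda>H :: real ^ 'a ^ 'a. H *v \<delta>)"
    by (intro linearI matrix_vector_mult_add_rdistrib scaleR_matrix_vector_assoc[symmetric])
  then have "bounded_linear (\<lambda>H :: real ^ 'a ^ 'a. H *v \<delta>)"
    by (rule linear_conv_bounded_linear[THEN iffD1])
  from has_integral_linear[OF integrable_integral[OF int] this]
  have "((\<lambda>\<tau>. hessian L (?\<gamma> \<tau>) *v \<delta>) has_integral
      (integral {0..1} (\<lambda>\<tau>. hessian L (?\<gamma> \<tau>)) *v \<delta>)) {0..1}"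
    by (simp only: o_def)
  from has_integral_unique[OF this ftc] show ?thesis
    by simp
qed

text \<open>The squared norms differ by \<mu> (\<mu> |d|^2 - 2 <d, h>). Since \<mu> is positive, the
  second factor decides the sign, and |d|^2 > 0 permits division.\<close>

lemma norm_scaleR_diff_less_iff:
  fixes d h :: "'a::real_inner"
  assumes "d \<noteq> 0" and "\<mu> > 0"
  shows "norm (\<mu> *\<^sub>R d - h) < norm h \<longleftrightarrow> \<mu> < 2 * ((d \<bullet> h) / (norm d)\<^sup>2)"
proof -
  have "norm (\<mu> *\<^sub>R d - h) < norm h \<longleftrightarrow> (norm (\<mu> *\<^sub>R d - h))\<^sup>2 < (norm h)\<^sup>2"
    by (simp add: norm_lt power2_norm_eq_inner)
  also have "(norm (\<mu> *\<^sub>R d - h))\<^sup>2 = \<mu> * (\<mu> * (norm d)\<^sup>2 - 2 * (d \<bullet> h)) + (norm h)\<^sup>2"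
    by (simp add: power2_norm_eq_inner algebra_simps inner_commute)
  also have "\<dots> < (norm h)\<^sup>2 \<longleftrightarrow> \<mu> * (norm d)\<^sup>2 < 2 * (d \<bullet> h)"
    using assms(2) by (simp add: mult_less_0_iff)
  also have "\<dots> \<longleftrightarrow> \<mu> < 2 * ((d \<bullet> h) / (norm d)\<^sup>2)"
    using assms(1) by (simp add: pos_less_divide_eq)
  finally show ?thesis .
qed

text \<open>The two parts have separate data: \<open>L\<close>, \<open>r\<^sub>0\<close> and
  \<open>\<mu>\<close> in (ii) correspond to the loss, s_0 and lambda there. Integrability is
  asserted in (i) because the expectation of a non-integrable function is 0 by convention. G is
  taken for every labelling, which makes the right side nonrandom.\<close>

theorem proposition1:
  fixes \<phi> :: "real ^ 'n \<Rightarrow> real ^ ('b::finite \<times> 'c::finite)"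
    and own :: "'n \<Rightarrow> 'b"
    and s\<^sub>0 :: "real ^ 'n"
    and lam :: real
    and M :: "'w measure"
    and Y :: "'b \<Rightarrow> 'w \<Rightarrow> 'c"
    and L :: "real ^ 'm \<Rightarrow> real"
    and r\<^sub>0 \<delta> :: "real ^ 'm"
    and U :: "(real ^ 'm) set"
  shows
    "(lam > 0 \<and>
      samplewise own \<phi> \<and>
      \<phi> differentiable (at s\<^sub>0) \<and>
      prob_space M \<and>
      prob_space.indep_vars M (\<lambda>_. count_space UNIV) Y UNIV \<and>
      (\<forall>j k. measure M {\<omega> \<in> space M. Y j \<omega> = k} = softmax (block (\<phi> s\<^sub>0) j) $ k)
      \<longrightarrow>
      (let w = 1 / real CARD('b);
           g\<^sub>0 = (\<lambda>\<omega>. grad (\<lambda>s. batch_ce_loss (\<lambda>j. Y j \<omega>) (\<phi> s)) s\<^sub>0);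
           B = (\<lambda>\<omega>. lam *\<^sub>R diag_of_vec (g\<^sub>0 \<omega> * g\<^sub>0 \<omega>));
           J = jacobian \<phi> (at s\<^sub>0)
       in integrable M B \<and>
          (\<forall>y. let \<Lambda> = hessian (batch_ce_loss y) (\<phi> s\<^sub>0);
                   G = transpose J ** \<Lambda> ** J
               in prob_space.expectation M B = (lam * w) *\<^sub>R diag_of_mat G)))
     \<and>
     (closed_segment r\<^sub>0 (r\<^sub>0 + \<delta>) \<subseteq> U \<and>
      twice_continuously_differentiable_on L U
      \<longrightarrow>
      (let g\<^sub>0 = grad L r\<^sub>0;
           g = grad L (r\<^sub>0 + \<delta>);
           D = diag_of_vec (g\<^sub>0 * g\<^sub>0);
           H = integral {0..1} (\<lambda>\<tau>. hessian L (r\<^sub>0 + \<tau> *\<^sub>R \<delta>));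
           lam_star = ((D *v \<delta>) \<bullet> (H *v \<delta>)) / (norm (D *v \<delta>))\<^sup>2
       in D *v \<delta> \<noteq> 0 \<longrightarrow>
          (\<forall>\<mu>>0. let g\<^sub>D = g\<^sub>0 + \<mu> *\<^sub>R (D *v \<delta>)
                  in norm (g\<^sub>D - g) < norm (g\<^sub>0 - g) \<longleftrightarrow> \<mu> < 2 * lam_star)))"
proof (intro conjI impI)
  assume *: "lam > 0 \<and> samplewise own \<phi> \<and> \<phi> differentiable (at s\<^sub>0) \<and> prob_space M \<and>
      prob_space.indep_vars M (\<lambda>_. count_space UNIV) Y UNIV \<and>
      (\<forall>j k. measure M {\<omega> \<in> space M. Y j \<omega> = k} = softmax (block (\<phi> s\<^sub>0) j) $ k)"
  then interpret prob_space M by blast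
  have "Y j \<in> M \<rightarrow>\<^sub>M count_space UNIV" for j
    using * by (auto simp: indep_vars_def2)
  then have "has_bochner_integral M
      (\<lambda>\<omega>. lam *\<^sub>R diag_of_vec (grad (\<lambda>s. batch_ce_loss (\<lambda>j. Y j \<omega>) (\<phi> s)) s\<^sub>0 *
        grad (\<lambda>s. batch_ce_loss (\<lambda>j. Y j \<omega>) (\<phi> s)) s\<^sub>0))
      ((lam * (1 / real CARD('b))) *\<^sub>R
        diag_of_mat (transpose (jacobian \<phi> (at s\<^sub>0)) ** hessian (batch_ce_loss y) (\<phi> s\<^sub>0) **
          jacobian \<phi> (at s\<^sub>0)))" for y
    using * by (intro expectation_diag_fisher) auto
  then show "let w = 1 / real CARD('b);
           g\<^sub>0 = (\<lambda>\<omega>. grad (\<lambda>s. batch_ce_loss (\<lambda>j. Y j \<omega>) (\<phi> s)) s\<^sub>0);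
           B = (\<lambda>\<omega>. lam *\<^sub>R diag_of_vec (g\<^sub>0 \<omega> * g\<^sub>0 \<omega>));
           J = jacobian \<phi> (at s\<^sub>0)
       in integrable M B \<and>
          (\<forall>y. let \<Lambda> = hessian (batch_ce_loss y) (\<phi> s\<^sub>0);
                   G = transpose J ** \<Lambda> ** J
               in prob_space.expectation M B = (lam * w) *\<^sub>R diag_of_mat G)"
    unfolding Let_def has_bochner_integral_iff by blast
next
  assume *: "closed_segment r\<^sub>0 (r\<^sub>0 + \<delta>) \<subseteq> U \<and> twice_continuously_differentiable_on L U"
  let ?D = "diag_of_vec (grad L r\<^sub>0 * grad L r\<^sub>0) *v \<delta>"
  let ?h = "integral {0..1} (\<lambda>\<tau>. hessian L (r\<^sub>0 + \<tau> *\<^sub>R \<delta>)) *v \<delta>"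
  have h: "?h = grad L (r\<^sub>0 + \<delta>) - grad L r\<^sub>0"
    using * by (intro grad_diff_eq_hessian_integral[of _ _ U]) auto
  \<comment> \<open>In terms of the averaged Hessian, the compensated error is \<mu> D \<delta> - H
    \<delta> and the reuse error is -H \<delta>, whose sign the norm ignores.\<close>
  have "norm (grad L r\<^sub>0 + \<mu> *\<^sub>R ?D - grad L (r\<^sub>0 + \<delta>)) = norm (\<mu> *\<^sub>R ?D - ?h)"
    "norm (grad L r\<^sub>0 - grad L (r\<^sub>0 + \<delta>)) = norm ?h" for \<mu>
    by (simp_all add: h norm_minus_commute algebra_simps)
  then show "let g\<^sub>0 = grad L r\<^sub>0;
           g = grad L (r\<^sub>0 + \<delta>);
           D = diag_of_vec (g\<^sub>0 * g\<^sub>0);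
           H = integral {0..1} (\<lambda>\<tau>. hessian L (r\<^sub>0 + \<tau> *\<^sub>R \<delta>));
           lam_star = ((D *v \<delta>) \<bullet> (H *v \<delta>)) / (norm (D *v \<delta>))\<^sup>2
       in D *v \<delta> \<noteq> 0 \<longrightarrow>
          (\<forall>\<mu>>0. let g\<^sub>D = g\<^sub>0 + \<mu> *\<^sub>R (D *v \<delta>)
                  in norm (g\<^sub>D - g) < norm (g\<^sub>0 - g) \<longleftrightarrow> \<mu> < 2 * lam_star)"
    unfolding Let_def using norm_scaleR_diff_less_iff[of ?D _ ?h] by simp
qed

end
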